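(* Let $d\ge2$ be an integer and put $d'=d-1\ge1$. Assume that there is a constant $c>0$ (possibly depending on the dimension) such that for every integer $n\ge0$ and all coefficients $\varepsilon_R\in\{-1,+1\}$ (indexed by $R\in\mathcal D^{d'}$ with $|R|\ge 2^{-n}$), $$\bigg\|\sum_{R\in\mathcal D^{d'}:\,|R|\ge2^{-n}}\varepsilon_R h_R\bigg\|_\infty\ \ge\ c\,n^{\frac{d'+1}{2}}=c\,n^{\frac d2}.$$ Then there is a constant $c'>0$ (possibly depending on the dimension) such that for every integer $n\ge0$ and all coefficients $\varepsilon_R\in\{-1,+1\}$ (indexed by $R\in\mathcal D^{d}$ with $|R|=2^{-n}$), $$\bigg\|\sum_{R\in\mathcal D^{d}:\,|R|=2^{-n}}\varepsilon_R h_R\bigg\|_\infty\ \ge\ c'\,n^{\frac d2}.$$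
   Context: $\mathcal D$ denotes the set of dyadic intervals in $[0,1)$, i.e. intervals $[m2^{-k},(m+1)2^{-k})$ with $k\in\{0,1,2,\dots\}$ and $m\in\{0,1,\dots,2^k-1\}$. For $I\in\mathcal D$, the ($L^\infty$-normalized) Haar function is $h_I=-\mathbf 1_{I_{left}}+\mathbf 1_{I_{right}}$, where $I_{left},I_{right}$ are the left and right (half-open) halves of $I$; so $h_I=0$ outside $I$. For an integer $s\ge1$, $\mathcal D^s$ is the set of dyadic boxes $R=R_1\times\dots\times R_s$ in $[0,1)^s$ with all $R_i\in\mathcal D$, $|R|$ is the volume, and $h_R(x)=h_{R_1}(x_1)\cdots h_{R_s}(x_s)$. $\|\cdot\|_\infty$ is the supremum norm on $[0,1)^s$. *)

theory Defs
  imports "HOL-Analysis.Analysis"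
begin

definition dyadic_intervals :: "real set set" where
  "dyadic_intervals = {{real m / 2 ^ k ..< real (m + 1) / 2 ^ k} | m k :: nat. m < 2 ^ k}"

definition left_half :: "real set \<Rightarrow> real set" where
  "left_half I = {Inf I ..< (Inf I + Sup I) / 2}"

definition right_half :: "real set \<Rightarrow> real set" where
  "right_half I = {(Inf I + Sup I) / 2 ..< Sup I}"

definition haar :: "real set \<Rightarrow> real \<Rightarrow> real" where
  "haar I x = - indicator (left_half I) x + indicator (right_half I) x"

text \<open>
  Since the dimension varies, coordinates are indexed by \<open>{..<s}\<close>: a point is an extensional
  function into the reals, and a box is represented by the extensional family of its sides, the
  set of its points being \<open>PiE {..<s} R\<close>. A dyadic interval is nonempty, so distinct
  families give distinct boxes.
\<close>

definition unit_cube :: "nat \<Rightarrow> (nat \<Rightarrow> real) set" where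
  "unit_cube s = PiE {..<s} (\<lambda>_. {0..<1})"

definition dyadic_boxes :: "nat \<Rightarrow> (nat \<Rightarrow> real set) set" where
  "dyadic_boxes s = PiE {..<s} (\<lambda>_. dyadic_intervals)"

definition box_volume :: "nat \<Rightarrow> (nat \<Rightarrow> real set) \<Rightarrow> real" where
  "box_volume s R = measure (PiM {..<s} (\<lambda>_. lborel)) (PiE {..<s} R)"

definition haar_box :: "nat \<Rightarrow> (nat \<Rightarrow> real set) \<Rightarrow> (nat \<Rightarrow> real) \<Rightarrow> real" where
  "haar_box s R x = (\<Prod>i<s. haar (R i) (x i))"

text \<open>
  The supremum is taken in the reals, so it is meaningful only for bounded functions on the cube;
  this covers all finite sums of Haar functions.
\<close>

definition sup_norm :: "nat \<Rightarrow> ((nat \<Rightarrow> real) \<Rightarrow> real) \<Rightarrow> real" where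
  "sup_norm s f = (SUP x\<in>unit_cube s. \<bar>f x\<bar>)"

lemma haar_Ico:
  assumes "a < b"
  shows "haar {a..<b} x =
    (if a \<le> x \<and> x < (a + b) / 2 then -1 else if (a + b) / 2 \<le> x \<and> x < b then 1 else 0)"
  using assms by (auto simp: haar_def left_half_def right_half_def indicator_def)

lemma box_volume_eq_prod:
  assumes "R \<in> dyadic_boxes s"
  shows "box_volume s R = (\<Prod>i<s. measure lborel (R i))"
proof -
  interpret product_sigma_finite "\<lambda>_::nat. lborel :: real measure" ..
  have R: "\<exists>a b. a \<le> b \<and> R i = {a..<b}" if "i < s" for i
  proof -
    have "R i \<in> dyadic_intervals"
      using assms that by (auto simp: dyadic_boxes_def PiE_iff)
    then obtain m k :: nat where "R i = {real m / 2 ^ k ..< real (m + 1) / 2 ^ k}"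
      unfolding dyadic_intervals_def by blast
    moreover have "real m / 2 ^ k \<le> real (m + 1) / 2 ^ k"
      by (rule divide_right_mono) auto
    ultimately show ?thesis
      by blast
  qed
  have m: "R i \<in> sets lborel" "emeasure lborel (R i) = ennreal (measure lborel (R i))" if i: "i < s" for i
  proof -
    obtain a b where "a \<le> b" "R i = {a..<b}"
      using R[OF i] by blast
    then show "R i \<in> sets lborel" "emeasure lborel (R i) = ennreal (measure lborel (R i))"
      by simp_all
  qed
  have "emeasure (PiM {..<s} (\<lambda>_. lborel)) (PiE {..<s} R) = (\<Prod>i<s. emeasure lborel (R i))"
    by (rule emeasure_PiM) (use m in auto)
  also have "\<dots> = (\<Prod>i<s. ennreal (measure lborel (R i)))"
    using m by (intro prod.cong) auto
  also have "\<dots> = ennreal (\<Prod>i<s. measure lborel (R i))"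
    by (simp add: prod_ennreal)
  finally show ?thesis
    by (simp add: box_volume_def measure_def prod_nonneg)
qed

end

theory Submission imports Defs begin

text \<open>
  Restrict the sum to the hyperplane where the last coordinate is \<open>0\<close>. There a Haar function
  in the last variable equals \<open>-1\<close> if its interval is \<open>[0, 2\<^sup>-\<^sup>k)\<close> and \<open>0\<close> otherwise. Since the volume of a box
  is fixed to be \<open>2\<^sup>-\<^sup>n\<close>, its first \<open>d - 1\<close> sides determine \<open>k\<close>, and they range over all boxes of
  volume at least \<open>2\<^sup>-\<^sup>n\<close>. So the restriction is a signed sum as in the hypothesis.
\<close>

lemma dyadic_intervalE:
  assumes "I \<in> dyadic_intervals"
  obtains m k :: nat where "I = {real m / 2 ^ k ..< real (m + 1) / 2 ^ k}" "m < 2 ^ k"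
    "measure lborel I = 1 / 2 ^ k"
proof -
  obtain m k :: nat where I: "I = {real m / 2 ^ k ..< real (m + 1) / 2 ^ k}" and m: "m < 2 ^ k"
    using assms unfolding dyadic_intervals_def by blast
  have le: "real m / 2 ^ k \<le> real (m + 1) / 2 ^ k"
    by (rule divide_right_mono) auto
  have "measure lborel I = 1 / 2 ^ k"
    unfolding I measure_lborel_Ico[OF le] by (simp add: diff_divide_distrib[symmetric])
  then show ?thesis
    using that I m by blast
qed

lemma dyadic_interval_initial: "{0..<1 / 2 ^ k} \<in> dyadic_intervals"
  unfolding dyadic_intervals_def
  by (rule CollectI, rule exI[of _ 0], rule exI[of _ k]) simp

lemma dyadic_interval_containing_0:
  assumes "I \<in> dyadic_intervals" "0 \<in> I"
  shows "I = {0..<measure lborel I}"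
proof -
  obtain m k :: nat where I: "I = {real m / 2 ^ k ..< real (m + 1) / 2 ^ k}"
    "measure lborel I = 1 / 2 ^ k"
    using assms(1) by (rule dyadic_intervalE)
  have "m = 0"
    using assms(2) unfolding I(1) by (auto simp: pos_divide_le_eq)
  with I show ?thesis by simp
qed

text \<open>A dyadic interval lies in [0,1), so it can contain 0 only as its left endpoint. This
  point belongs to the left half, where the Haar function is -1.\<close>

lemma haar_dyadic_0:
  assumes "I \<in> dyadic_intervals"
  shows "haar I 0 = (if 0 \<in> I then -1 else 0)"
proof -
  obtain m k :: nat where I: "I = {real m / 2 ^ k ..< real (m + 1) / 2 ^ k}"
    using assms by (rule dyadic_intervalE)
  have lt: "real m / 2 ^ k < real (m + 1) / 2 ^ k"
    by (rule divide_strict_right_mono) auto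
  show ?thesis
    unfolding I haar_Ico[OF lt] by (auto simp: field_simps)
qed

lemma abs_haar_le_1: "\<bar>haar I x\<bar> \<le> 1"
  by (auto simp: haar_def left_half_def right_half_def indicator_def)

lemma abs_haar_box_le_1: "\<bar>haar_box s R x\<bar> \<le> 1"
  unfolding haar_box_def abs_prod by (rule prod_le_1) (auto simp: abs_haar_le_1)

lemma dyadic_boxes_component: "R \<in> dyadic_boxes s \<Longrightarrow> i < s \<Longrightarrow> R i \<in> dyadic_intervals"
  by (auto simp: dyadic_boxes_def)

text \<open>The exponents of the sides add up. That the volume is a power of 1/2 is what later makes
  the side added by \<open>extend_box\<close> a dyadic interval.\<close>

lemma box_volume_dyadic:
  assumes "R \<in> dyadic_boxes s"
  obtains m :: nat where "box_volume s R = 1 / 2 ^ m"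
proof -
  have "\<forall>i<s. \<exists>k::nat. measure lborel (R i) = 1 / 2 ^ k"
    using dyadic_intervalE[OF dyadic_boxes_component[OF assms]] by metis
  then obtain k :: "nat \<Rightarrow> nat" where k: "\<And>i. i < s \<Longrightarrow> measure lborel (R i) = 1 / 2 ^ k i"
    by metis
  have "box_volume s R = (\<Prod>i<s. 1 / 2 ^ k i)"
    unfolding box_volume_eq_prod[OF assms] using k by (intro prod.cong) auto
  also have "\<dots> = 1 / 2 ^ (\<Sum>i<s. k i)"
    by (simp add: prod_dividef power_sum)
  finally show ?thesis by (rule that)
qed

lemma finite_dyadic_intervals_ge: "finite {I \<in> dyadic_intervals. 1 / 2 ^ n \<le> measure lborel I}"
proof (rule finite_subset)
  show "finite ((\<lambda>(m, k). {real m / 2 ^ k ..< real (m + 1) / 2 ^ k}) ` ({..<2 ^ n} \<times> {..n}))"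
    by simp
  show "{I \<in> dyadic_intervals. 1 / 2 ^ n \<le> measure lborel I} \<subseteq>
      (\<lambda>(m, k). {real m / 2 ^ k ..< real (m + 1) / 2 ^ k}) ` ({..<2 ^ n} \<times> {..n})"
  proof
    fix I assume "I \<in> {I \<in> dyadic_intervals. 1 / 2 ^ n \<le> measure lborel I}"
    then have I: "I \<in> dyadic_intervals" and n: "1 / 2 ^ n \<le> measure lborel I" by auto
    obtain m k :: nat where mk: "I = {real m / 2 ^ k ..< real (m + 1) / 2 ^ k}" "m < 2 ^ k"
      "measure lborel I = 1 / 2 ^ k"
      using I by (rule dyadic_intervalE)
    have "(2::real) ^ k \<le> 2 ^ n"
      using n unfolding mk(3) by (simp add: field_simps)
    then have "k \<le> n" by simp
    moreover from this have "m < 2 ^ n"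
      using mk(2) power_increasing[of k n "2::nat"] by linarith
    ultimately show "I \<in> (\<lambda>(m, k). {real m / 2 ^ k ..< real (m + 1) / 2 ^ k}) ` ({..<2 ^ n} \<times> {..n})"
      using mk(1) by force
  qed
qed

text \<open>All sides have length at most 1, so a lower bound on the volume bounds each side from
  below. Finiteness is needed to discard the vanishing terms of the sum on the hyperplane.\<close>

lemma finite_dyadic_boxes_ge: "finite {R \<in> dyadic_boxes s. 1 / 2 ^ n \<le> box_volume s R}"
proof (rule finite_subset)
  let ?D = "{I \<in> dyadic_intervals. 1 / 2 ^ n \<le> measure lborel I}"
  show "finite (PiE {..<s} (\<lambda>_. ?D))"
    by (intro finite_PiE) (auto simp: finite_dyadic_intervals_ge)
  show "{R \<in> dyadic_boxes s. 1 / 2 ^ n \<le> box_volume s R} \<subseteq> PiE {..<s} (\<lambda>_. ?D)"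
  proof
    fix R assume "R \<in> {R \<in> dyadic_boxes s. 1 / 2 ^ n \<le> box_volume s R}"
    then have R: "R \<in> dyadic_boxes s" and n: "1 / 2 ^ n \<le> box_volume s R" by auto
    have "1 / 2 ^ n \<le> measure lborel (R i)" if i: "i < s" for i
    proof -
      have le1: "measure lborel (R j) \<le> 1" if "j < s" for j
        using dyadic_boxes_component[OF R that] by (elim dyadic_intervalE) simp
      have "box_volume s R = measure lborel (R i) * (\<Prod>j\<in>{..<s} - {i}. measure lborel (R j))"
        unfolding box_volume_eq_prod[OF R] using i by (simp add: prod.remove)
      \<comment> \<open>The product over the other sides has all its factors in [0,1].\<close>
      also have "\<dots> \<le> measure lborel (R i) * 1"
        using le1 by (intro mult_left_mono prod_le_1) auto
      finally show ?thesis using n by simp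
    qed
    with R show "R \<in> PiE {..<s} (\<lambda>_. ?D)"
      by (auto simp: dyadic_boxes_def PiE_iff)
  qed
qed

text \<open>A real supremum dominates the values only for a function that is bounded above. Haar
  functions are at most 1 in absolute value, so the sum of all \<open>\<bar>e R\<bar>\<close> is a
  bound uniform in the point.\<close>

lemma abs_le_sup_norm_haar_sum:
  assumes "x \<in> unit_cube s"
  shows "\<bar>\<Sum>R\<in>A. e R * haar_box s R x\<bar> \<le> sup_norm s (\<lambda>x. \<Sum>R\<in>A. e R * haar_box s R x)"
  unfolding sup_norm_def
proof (rule cSUP_upper[OF assms])
  have "\<bar>\<Sum>R\<in>A. e R * haar_box s R y\<bar> \<le> (\<Sum>R\<in>A. \<bar>e R\<bar>)" for y
  proof (rule order_trans[OF sum_abs sum_mono])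
    show "\<bar>e R * haar_box s R y\<bar> \<le> \<bar>e R\<bar>" for R
      using mult_left_mono[OF abs_haar_box_le_1[of s R y], of "\<bar>e R\<bar>"] by (simp add: abs_mult)
  qed
  then show "bdd_above ((\<lambda>y. \<bar>\<Sum>R\<in>A. e R * haar_box s R y\<bar>) ` unit_cube s)"
    by (intro bdd_aboveI2)
qed

lemma box_volume_Suc:
  assumes "R \<in> dyadic_boxes (Suc s)"
  shows "box_volume (Suc s) R = box_volume s (restrict R {..<s}) * measure lborel (R s)"
proof -
  have "restrict R {..<s} \<in> dyadic_boxes s"
    using assms by (auto simp: dyadic_boxes_def)
  then show ?thesis
    using assms by (simp add: box_volume_eq_prod)
qed

lemma haar_box_Suc:
  "haar_box (Suc s) R (x(s := t)) = haar_box s (restrict R {..<s}) x * haar (R s) t"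
  by (simp add: haar_box_def)

text \<open>The new side starts at 0, and its length is the one that brings the total volume to
  \<open>1 / 2 ^ n\<close>.\<close>

definition extend_box :: "nat \<Rightarrow> nat \<Rightarrow> (nat \<Rightarrow> real set) \<Rightarrow> nat \<Rightarrow> real set" where
  "extend_box s n R = R(s := {0..<1 / (2 ^ n * box_volume s R)})"

lemma restrict_extend_box:
  assumes "R \<in> dyadic_boxes s"
  shows "restrict (extend_box s n R) {..<s} = R"
  using assms by (auto simp: extend_box_def dyadic_boxes_def PiE_iff extensional_def)

text \<open>The volume bound on \<open>R\<close> ensures that the length of the new side is at most
  1, so that this side is a dyadic interval in [0,1).\<close>

lemma extend_box_props:
  assumes R: "R \<in> dyadic_boxes s" and n: "1 / 2 ^ n \<le> box_volume s R"
  shows "extend_box s n R \<in> dyadic_boxes (Suc s)"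
    and "box_volume (Suc s) (extend_box s n R) = 1 / 2 ^ n"
    and "0 \<in> extend_box s n R s"
proof -
  obtain m :: nat where m: "box_volume s R = 1 / 2 ^ m"
    using R by (rule box_volume_dyadic)
  have "(2::real) ^ m \<le> 2 ^ n"
    using n unfolding m by (simp add: field_simps)
  then have "m \<le> n" by simp
  \<comment> \<open>The prescribed length is \<open>2 ^ m / 2 ^ n\<close>; because
    \<open>m \<le> n\<close>, the subtraction of naturals is exact.\<close>
  then have side: "extend_box s n R s = {0..<1 / 2 ^ (n - m)}"
    by (simp add: extend_box_def m power_diff)
  show ext: "extend_box s n R \<in> dyadic_boxes (Suc s)"
    using R dyadic_interval_initial[of "n - m"] side
    by (auto simp: extend_box_def dyadic_boxes_def PiE_iff extensional_def less_Suc_eq)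
  show "0 \<in> extend_box s n R s"
    unfolding side by simp
  show "box_volume (Suc s) (extend_box s n R) = 1 / 2 ^ n"
    unfolding box_volume_Suc[OF ext] restrict_extend_box[OF R] side m
    using \<open>m \<le> n\<close> by (simp add: power_add[symmetric])
qed

text \<open>A dyadic interval containing 0 is determined by its length, and the fixed total volume
  determines that length from the other sides. Hence forgetting the last side loses no
  information.\<close>

lemma extend_box_restrict:
  assumes R: "R \<in> dyadic_boxes (Suc s)" and n: "box_volume (Suc s) R = 1 / 2 ^ n"
    and 0: "0 \<in> R s"
  shows "restrict R {..<s} \<in> dyadic_boxes s"
    and "1 / 2 ^ n \<le> box_volume s (restrict R {..<s})"
    and "extend_box s n (restrict R {..<s}) = R"
proof -
  let ?R = "restrict R {..<s}"
  show "?R \<in> dyadic_boxes s"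
    using R by (auto simp: dyadic_boxes_def)
  have Rs: "R s \<in> dyadic_intervals"
    using R by (rule dyadic_boxes_component) simp
  obtain k :: nat where k: "measure lborel (R s) = 1 / 2 ^ k"
    using Rs by (rule dyadic_intervalE)
  have v: "box_volume s ?R = 2 ^ k / 2 ^ n"
    using box_volume_Suc[OF R] n k by (simp add: field_simps)
  show "1 / 2 ^ n \<le> box_volume s ?R"
    unfolding v by (intro divide_right_mono) auto
  have "R s = {0..<1 / (2 ^ n * box_volume s ?R)}"
    using dyadic_interval_containing_0[OF Rs 0] by (simp add: k v)
  then show "extend_box s n ?R = R"
    using R by (fastforce simp: extend_box_def dyadic_boxes_def PiE_iff extensional_def fun_eq_iff less_Suc_eq)
qed

text \<open>Boxes whose last side misses 0 contribute nothing. Each remaining box has last factor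
  -1, which is the source of the minus sign in the new coefficients.\<close>

lemma haar_sum_restrict_hyperplane:
  "(\<Sum>R \<in> {R \<in> dyadic_boxes (Suc s). box_volume (Suc s) R = 1 / 2 ^ n}.
      e R * haar_box (Suc s) R (x(s := 0))) =
   (\<Sum>R \<in> {R \<in> dyadic_boxes s. box_volume s R \<ge> 1 / 2 ^ n}.
      - e (extend_box s n R) * haar_box s R x)"
    (is "sum ?f ?A = sum ?g ?B")
proof -
  let ?C = "{R \<in> ?A. 0 \<in> R s}"
  have "sum ?f ?A = sum ?f ?C"
  proof (rule sum.mono_neutral_right)
    show "finite ?A"
      by (rule finite_subset[OF _ finite_dyadic_boxes_ge[of "Suc s" n]]) auto
    show "\<forall>R\<in>?A - ?C. ?f R = 0"
      by (auto simp: haar_box_Suc haar_dyadic_0 dyadic_boxes_component split: if_splits)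
  qed auto
  also have "\<dots> = sum ?g ?B"
    \<comment> \<open>Extending a box and dropping its last side are mutually inverse between
      \<open>?B\<close> and \<open>?C\<close>.\<close>
    by (rule sum.reindex_bij_witness[of _ "extend_box s n" "\<lambda>R. restrict R {..<s}"])
      (auto simp: extend_box_props extend_box_restrict restrict_extend_box haar_box_Suc
        haar_dyadic_0 dyadic_boxes_component)
  finally show ?thesis .
qed

theorem lemma11:
  fixes d :: nat
  assumes "d \<ge> 2"
    and "\<exists>c>0. \<forall>n::nat. \<forall>\<epsilon> :: (nat \<Rightarrow> real set) \<Rightarrow> real.
      (\<forall>R \<in> {R \<in> dyadic_boxes (d - 1). box_volume (d - 1) R \<ge> 1 / 2 ^ n}. \<epsilon> R \<in> {-1, 1}) \<longrightarrow>
      sup_norm (d - 1) (\<lambda>x. \<Sum>R \<in> {R \<in> dyadic_boxes (d - 1). box_volume (d - 1) R \<ge> 1 / 2 ^ n}.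
          \<epsilon> R * haar_box (d - 1) R x)
        \<ge> c * real n powr ((real (d - 1) + 1) / 2)"
  shows "\<exists>c'>0. \<forall>n::nat. \<forall>\<epsilon> :: (nat \<Rightarrow> real set) \<Rightarrow> real.
      (\<forall>R \<in> {R \<in> dyadic_boxes d. box_volume d R = 1 / 2 ^ n}. \<epsilon> R \<in> {-1, 1}) \<longrightarrow>
      sup_norm d (\<lambda>x. \<Sum>R \<in> {R \<in> dyadic_boxes d. box_volume d R = 1 / 2 ^ n}.
          \<epsilon> R * haar_box d R x)
        \<ge> c' * real n powr (real d / 2)"
proof -
  define s where "s = d - 1"
  have d: "d = Suc s"
    using assms(1) by (simp add: s_def)
  let ?B = "\<lambda>n. {R \<in> dyadic_boxes s. box_volume s R \<ge> 1 / 2 ^ n}"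
  let ?A = "\<lambda>n. {R \<in> dyadic_boxes d. box_volume d R = 1 / 2 ^ n}"
  obtain c :: real where c: "c > 0" and bound: "\<And>(n::nat) (\<epsilon> :: (nat \<Rightarrow> real set) \<Rightarrow> real).
      \<forall>R \<in> ?B n. \<epsilon> R \<in> {-1, 1} \<Longrightarrow>
      sup_norm s (\<lambda>x. \<Sum>R \<in> ?B n. \<epsilon> R * haar_box s R x) \<ge> c * real n powr ((real s + 1) / 2)"
    using assms(2) unfolding s_def[symmetric] by blast
  have "sup_norm d (\<lambda>x. \<Sum>R \<in> ?A n. \<epsilon> R * haar_box d R x) \<ge> c * real n powr (real d / 2)"
    if \<epsilon>: "\<forall>R \<in> ?A n. \<epsilon> R \<in> {-1, 1}" for n :: nat and \<epsilon> :: "(nat \<Rightarrow> real set) \<Rightarrow> real"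
  proof -
    \<comment> \<open>These coefficients are again signs, so the assumed bound in dimension
      \<open>s\<close> applies to them.\<close>
    let ?\<delta> = "\<lambda>R. - \<epsilon> (extend_box s n R)"
    have "?\<delta> R \<in> {-1, 1}" if "R \<in> ?B n" for R
    proof -
      have "extend_box s n R \<in> ?A n"
        using that extend_box_props[of R s n] by (simp add: d)
      then have "\<epsilon> (extend_box s n R) \<in> {-1, 1}"
        using \<epsilon> by blast
      then show ?thesis by auto
    qed
    then have "c * real n powr ((real s + 1) / 2)
        \<le> sup_norm s (\<lambda>x. \<Sum>R \<in> ?B n. ?\<delta> R * haar_box s R x)"
      by (intro bound) blast
    \<comment> \<open>Every value of the lower-dimensional sum is attained by the full sum at the
      lifted point \<open>x(s := 0)\<close>.\<close>
    also have "\<dots> \<le> sup_norm d (\<lambda>x. \<Sum>R \<in> ?A n. \<epsilon> R * haar_box d R x)"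
      unfolding sup_norm_def[of s]
    proof (rule cSUP_least)
      show "unit_cube s \<noteq> {}"
        by (auto simp: unit_cube_def PiE_eq_empty_iff)
      fix x assume "x \<in> unit_cube s"
      then have "x(s := 0) \<in> unit_cube d"
        by (auto simp: unit_cube_def d PiE_iff extensional_def less_Suc_eq)
      then show "\<bar>\<Sum>R \<in> ?B n. ?\<delta> R * haar_box s R x\<bar>
          \<le> sup_norm d (\<lambda>x. \<Sum>R \<in> ?A n. \<epsilon> R * haar_box d R x)"
        unfolding haar_sum_restrict_hyperplane[symmetric] d[symmetric]
        by (rule abs_le_sup_norm_haar_sum)
    qed
    \<comment> \<open>Since \<open>d = Suc s\<close>, the two exponents agree, and the same constant
      \<open>c\<close> serves as \<open>c'\<close>.\<close>
    finally show ?thesis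
      by (simp add: d add.commute)
  qed
  with c show ?thesis by blast
qed

end
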